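(* Let $p,K\ge1$ be integers, $N=pK$, $L>0$, $R>0$, and let $f:\mathbb{R}^d\to\mathbb{R}$ be a convex $L$-smooth function having a minimizer $x^{( * )}$. Consider $N$ steps on $f$ of one of the following algorithms: cyclic coordinate descent (CCD), alternating minimization (AM), or cyclic accelerated coordinate descent (CACD), with the initial condition $\mathcal{I}\le R^2$ satisfied. Then the performance $\mathcal{P}(f)$ of these $N$ steps satisfies $$\mathcal{P}(f)\le\mathcal{W}_L(p,K,R),$$ where $\mathcal{W}_L(p,K,R)$ is the value of the performance estimation problem associated with the algorithm, the performance criterion $\mathcal{P}$ and the initial measure $\mathcal{I}$.
   Context: Blocks. $\mathbb{R}^d=\mathbb{R}^{d_1}\times\dots\times\mathbb{R}^{d_p}$ is fixed, with selection matrices $U_i\in\mathbb{R}^{d\times d_i}$ such that $(U_1,\dots,U_p)$ is the $d\times d$ identity; $x_i=U_i^Tx$ for $x\in\mathbb{R}^d$, and $\nabla_i f(x)=U_i^T\nabla f(x)$. Norms are Euclidean. A differentiable $f$ is $L$-smooth if $\|\nabla f(x+h)-\nabla f(x)\|\le L\|h\|$ for all $x,h\in\mathbb{R}^d$. Algorithms. For $n=1,\dots,N$ put $i=\mathrm{mod}(n,p)+1$. (CCD) Given $x^{(0)}$ and a step-size $\alpha$: $x^{(n)}=x^{(n-1)}-\alpha U_i\nabla_if(x^{(n-1)})$. (AM) Given $x^{(0)}$: $x^{(n)}$ is a minimizer of $f$ over $\{x^{(n-1)}+U_i\Delta:\Delta\in\mathbb{R}^{d_i}\}$. (CACD) Given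 $z^{(0)}=x^{(0)}$ and $\theta_0=1/p$: $y^{(n-1)}=(1-\theta_{n-1})x^{(n-1)}+\theta_{n-1}z^{(n-1)}$, $z^{(n)}=z^{(n-1)}-\frac{1}{p\theta_{n-1}L}U_i\nabla_if(y^{(n-1)})$, $x^{(n)}=y^{(n-1)}+p\theta_{n-1}(z^{(n)}-z^{(n-1)})$, $\theta_n=\frac12\left(\sqrt{\theta_{n-1}^4+4\theta_{n-1}^2}-\theta_{n-1}^2\right)$. Data set and criteria. $\mathcal{O}=\{(x^{(n)},g^{(n)},f^{(n)})\}_{n\in J\cup\{*\}}\subset\mathbb{R}^d\times\mathbb{R}^d\times\mathbb{R}$, where $J$ indexes the iterates $x^{(0)},\dots,x^{(N)}$ and, for (CACD), also the points $y^{(0)},\dots,y^{(N-1)}$, and where $*$ stands for a minimizer. The performance criterion $\mathcal{P}$ and the initial measure $\mathcal{I}$ are real-valued functions of $\mathcal{O}$ (e.g. $\mathcal{P}(\mathcal{O})=f^{(N)}-f^{( * )}$ or $\|g^{(N)}\|^2$, and $\mathcal{I}(\mathcal{O})=\|x^{(0)}-x^{( * )}\|^2$). For a run of an algorithm on a function $f$ with minimizer $x^{( * )}$, $\mathcal{P}(f)$ and $\mathcal{I}$ denote the values of these functions at the data set $\mathcal{O}$ in which each $g^{(n)}$ is the gradient of $f$ and each $f^{(n)}$ the value of $f$ at the corresponding point. Performance estimation problem. $\mathcal{W}_L(p,K,R)$ is the supremum (in the extended reals) of $\mathcal{P}(\mathcal{O})$ over all data sets $\mathcal{O}$ such that: (i)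 $g^{( * )}=0$; (ii) for all $n,l\in J\cup\{*\}$, $$f^{(n)}\ge f^{(l)}+\sum_{i=1}^p\langle g^{(l)}_i,x^{(n)}_i-x^{(l)}_i\rangle+\frac{1}{2L}\sum_{i=1}^p\|g^{(n)}_i-g^{(l)}_i\|^2$$ (for (CACD), with the points $y^{(n)}$ included among the $x$'s); (iii) $\mathcal{I}(\mathcal{O})\le R^2$; (iv) the points satisfy the update rules of the algorithm with each $\nabla_if$ replaced by the corresponding $g_i$, where for (AM) the rule at step $n$ is $x^{(n)}_j=x^{(n-1)}_j$ for $j\neq i$ and $g^{(n)}_i=0$. *)

theory Defs
  imports "HOL-Analysis.Analysis"
begin

(* The block structure of R^d, d = CARD('n), is given by a map blk assigning to every coordinate
   the number in {1..p} of its block; block i has dimension d_i = card {k. blk k = i}.  Since the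
   type of a matrix cannot depend on i, the d x d_i selection matrix U_i is padded with zero
   columns to a d x d matrix: the columns indexed by block i are the unit vectors.  Accordingly
   x_i = U_i^T x is x_i padded with zeros, which affects neither norms, nor inner products, nor
   the products U_i x_i, nor the set of all U_i Delta. *)

definition U :: "('n::finite \<Rightarrow> nat) \<Rightarrow> nat \<Rightarrow> real^'n^'n" where
  "U blk i = (\<chi> k l. if k = l \<and> blk l = i then 1 else 0)"

definition block :: "('n::finite \<Rightarrow> nat) \<Rightarrow> nat \<Rightarrow> real^'n \<Rightarrow> real^'n" where
  "block blk i x = transpose (U blk i) *v x"

definition grad :: "(real^'n \<Rightarrow> real) \<Rightarrow> real^'n \<Rightarrow> real^'n" where
  "grad f x = (THE D. GDERIV f x :> D)"

definition smooth :: "real \<Rightarrow> (real^'n \<Rightarrow> real) \<Rightarrow> bool" where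
  "smooth L f \<longleftrightarrow> (\<forall>x. f differentiable (at x)) \<and>
     (\<forall>x h. norm (grad f (x + h) - grad f x) \<le> L * norm h)"

(* The argument of CCD is the step-size. *)
datatype algorithm = CCD real | AM | CACD

definition cyc :: "nat \<Rightarrow> nat \<Rightarrow> nat" where
  "cyc p n = n mod p + 1"

primrec theta :: "nat \<Rightarrow> nat \<Rightarrow> real" where
  "theta p 0 = 1 / real p"
| "theta p (Suc n) = (sqrt (theta p n ^ 4 + 4 * theta p n ^ 2) - theta p n ^ 2) / 2"

(* In the update rules of CCD and CACD the gradients are parameters: in a run of the algorithm
   gx n and gy n are the gradients of f at x n and y n, in the performance estimation problem
   they are the vectors g of the data set. *)

definition ccd_updates ::
  "('n::finite \<Rightarrow> nat) \<Rightarrow> nat \<Rightarrow> nat \<Rightarrow> real \<Rightarrow> (nat \<Rightarrow> real^'n) \<Rightarrow> (nat \<Rightarrow> real^'n) \<Rightarrow> bool" where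
  "ccd_updates blk p N \<alpha> x gx \<longleftrightarrow>
     (\<forall>n\<in>{1..N}. x n = x (n-1) - \<alpha> *\<^sub>R (U blk (cyc p n) *v block blk (cyc p n) (gx (n-1))))"

definition cacd_updates ::
  "('n::finite \<Rightarrow> nat) \<Rightarrow> nat \<Rightarrow> nat \<Rightarrow> real \<Rightarrow> (nat \<Rightarrow> real^'n) \<Rightarrow> (nat \<Rightarrow> real^'n) \<Rightarrow>
     (nat \<Rightarrow> real^'n) \<Rightarrow> bool" where
  "cacd_updates blk p N L x y gy \<longleftrightarrow>
     (\<exists>z. z 0 = x 0 \<and>
       (\<forall>n\<in>{1..N}.
          y (n-1) = (1 - theta p (n-1)) *\<^sub>R x (n-1) + theta p (n-1) *\<^sub>R z (n-1) \<and>
          z n = z (n-1) - (1 / (real p * theta p (n-1) * L)) *\<^sub>R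
                  (U blk (cyc p n) *v block blk (cyc p n) (gy (n-1))) \<and>
          x n = y (n-1) + (real p * theta p (n-1)) *\<^sub>R (z n - z (n-1))))"

(* Runs of the algorithms on f; y is only used by CACD. *)
fun is_run ::
  "('n::finite \<Rightarrow> nat) \<Rightarrow> algorithm \<Rightarrow> real \<Rightarrow> nat \<Rightarrow> nat \<Rightarrow> (real^'n \<Rightarrow> real) \<Rightarrow>
     (nat \<Rightarrow> real^'n) \<Rightarrow> (nat \<Rightarrow> real^'n) \<Rightarrow> bool" where
  "is_run blk (CCD \<alpha>) L p N f x y \<longleftrightarrow> ccd_updates blk p N \<alpha> x (\<lambda>n. grad f (x n))"
| "is_run blk AM L p N f x y \<longleftrightarrow>
     (\<forall>n\<in>{1..N}. is_arg_min f (\<lambda>w. w \<in> {x (n-1) + U blk (cyc p n) *v \<Delta> | \<Delta>. True}) (x n))"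
| "is_run blk CACD L p N f x y \<longleftrightarrow> cacd_updates blk p N L x y (\<lambda>n. grad f (y n))"

datatype point_index = X nat | Y nat | Star

definition indices :: "algorithm \<Rightarrow> nat \<Rightarrow> point_index set" where
  "indices alg N =
     X ` {0..N} \<union> (if alg = CACD then Y ` {0..<N} else {}) \<union> {Star}"

(* Data sets are families of triples (point, gradient, value) over indices alg N.  They are
   represented by functions that are undefined outside indices alg N, so that real-valued
   functions of a data set depend on the entries in the family only. *)
type_synonym 'n dataset = "point_index \<Rightarrow> (real^'n) \<times> (real^'n) \<times> real"

definition pt :: "'n dataset \<Rightarrow> point_index \<Rightarrow> real^'n" where "pt S j = fst (S j)"
definition gr :: "'n dataset \<Rightarrow> point_index \<Rightarrow> real^'n" where "gr S j = fst (snd (S j))"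
definition fv :: "'n dataset \<Rightarrow> point_index \<Rightarrow> real" where "fv S j = snd (snd (S j))"

fun run_point :: "(nat \<Rightarrow> real^'n) \<Rightarrow> (nat \<Rightarrow> real^'n) \<Rightarrow> real^'n \<Rightarrow> point_index \<Rightarrow> real^'n" where
  "run_point x y xstar (X n) = x n"
| "run_point x y xstar (Y n) = y n"
| "run_point x y xstar Star = xstar"

definition run_data ::
  "algorithm \<Rightarrow> nat \<Rightarrow> (real^'n \<Rightarrow> real) \<Rightarrow> (nat \<Rightarrow> real^'n) \<Rightarrow> (nat \<Rightarrow> real^'n) \<Rightarrow> real^'n \<Rightarrow>
     'n dataset" where
  "run_data alg N f x y xstar =
     (\<lambda>j\<in>indices alg N. let w = run_point x y xstar j in (w, grad f w, f w))"

fun pep_updates ::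
  "('n::finite \<Rightarrow> nat) \<Rightarrow> algorithm \<Rightarrow> real \<Rightarrow> nat \<Rightarrow> nat \<Rightarrow> 'n dataset \<Rightarrow> bool" where
  "pep_updates blk (CCD \<alpha>) L p N S \<longleftrightarrow>
     ccd_updates blk p N \<alpha> (\<lambda>n. pt S (X n)) (\<lambda>n. gr S (X n))"
| "pep_updates blk AM L p N S \<longleftrightarrow>
     (\<forall>n\<in>{1..N}.
        (\<forall>j\<in>{1..p}. j \<noteq> cyc p n \<longrightarrow> block blk j (pt S (X n)) = block blk j (pt S (X (n-1)))) \<and>
        block blk (cyc p n) (gr S (X n)) = 0)"
| "pep_updates blk CACD L p N S \<longleftrightarrow>
     cacd_updates blk p N L (\<lambda>n. pt S (X n)) (\<lambda>n. pt S (Y n)) (\<lambda>n. gr S (Y n))"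

definition pep_feasible ::
  "('n::finite \<Rightarrow> nat) \<Rightarrow> algorithm \<Rightarrow> ('n dataset \<Rightarrow> real) \<Rightarrow> real \<Rightarrow> nat \<Rightarrow> nat \<Rightarrow> real \<Rightarrow>
     'n dataset set" where
  "pep_feasible blk alg Init L p K R =
     {S \<in> extensional (indices alg (p * K)).
        gr S Star = 0 \<and>
        (\<forall>n\<in>indices alg (p * K). \<forall>l\<in>indices alg (p * K).
           fv S n \<ge> fv S l
             + (\<Sum>i=1..p. block blk i (gr S l) \<bullet> (block blk i (pt S n) - block blk i (pt S l)))
             + 1 / (2 * L) * (\<Sum>i=1..p. (norm (block blk i (gr S n) - block blk i (gr S l)))\<^sup>2)) \<and>
        Init S \<le> R\<^sup>2 \<and>
        pep_updates blk alg L p (p * K) S}"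

definition pep_value ::
  "('n::finite \<Rightarrow> nat) \<Rightarrow> algorithm \<Rightarrow> ('n dataset \<Rightarrow> real) \<Rightarrow> ('n dataset \<Rightarrow> real) \<Rightarrow>
     real \<Rightarrow> nat \<Rightarrow> nat \<Rightarrow> real \<Rightarrow> ereal" where
  "pep_value blk alg Perf Init L p K R =
     (SUP S \<in> pep_feasible blk alg Init L p K R. ereal (Perf S))"

end

theory Submission
  imports Defs
begin

text \<open>
  The value of the performance estimation problem is a supremum over data sets, so it suffices that
  the data set sampled from the run of the algorithm on \<open>f\<close> is feasible. The interpolation
  inequalities hold for the values and gradients of any \<open>L\<close>-smooth convex function
  (\<open>smooth_convex_interpolation\<close>): the minorant of \<open>f\<close> given by the tangent plane at
  \<open>x\<close> is compared with the quadratic majorant at \<open>y\<close>, and the comparison is evaluated where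
  the gap between the two is smallest. Since the blocks partition the coordinates, inner products
  and squared norms are the sums of their blockwise contributions, which gives the inequalities in
  the form used by the problem.

  The update rules of coordinate descent and of its accelerated variant are literally those of the
  problem. For alternating minimization, and for the condition on the minimizer, the gradient of a
  differentiable function is orthogonal to every line along which the point is minimal; moving along
  the (block of the) gradient itself shows that this block or the whole gradient vanishes
  (\<open>block_grad_of_exact_step\<close>, \<open>grad_of_global_min\<close>).
\<close>

section \<open>Gradients and directional derivatives\<close>

text \<open>
  The definite description in \<^const>\<open>grad\<close> denotes: the derivative is a linear functional, and it
  is represented as an inner product by the vector that its adjoint assigns to \<open>1\<close>, which is the
  only such vector because derivatives are unique.
\<close>
lemma GDERIV_grad:
  assumes "f differentiable (at x)"
  shows "GDERIV f x :> grad f x"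
proof -
  obtain f' where f': "(f has_derivative f') (at x)"
    using assms unfolding differentiable_def by blast
  then have "linear f'" by (simp add: has_derivative_linear)
  then have "f' = (\<lambda>h. h \<bullet> adjoint f' 1)"
    by (simp add: fun_eq_iff adjoint_works)
  then have D: "GDERIV f x :> adjoint f' 1"
    using f' unfolding gderiv_def by simp
  have "D = adjoint f' 1" if "GDERIV f x :> D" for D
  proof -
    have "(\<lambda>h. h \<bullet> D) = (\<lambda>h. h \<bullet> adjoint f' 1)"
      using that D unfolding gderiv_def by (rule has_derivative_unique)
    then have "h \<bullet> D = h \<bullet> adjoint f' 1" for h by (simp add: fun_eq_iff)
    then show ?thesis using vector_eq_ldot by blast
  qed
  then show ?thesis
    unfolding grad_def using D by (metis theI)
qed

text \<open>
  Restriction to lines reduces smoothness, convexity and minimality of \<open>f\<close> to statements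
  about functions of one real variable.
\<close>
lemma DERIV_along_line:
  assumes "\<And>z. f differentiable (at z)"
  shows "((\<lambda>t. f (x + t *\<^sub>R h)) has_real_derivative grad f (x + t *\<^sub>R h) \<bullet> h) (at t)"
proof -
  have "(f has_derivative (\<lambda>k. k \<bullet> grad f (x + t *\<^sub>R h))) (at (x + t *\<^sub>R h))"
    using GDERIV_grad[OF assms[of "x + t *\<^sub>R h"]] unfolding gderiv_def .
  moreover have "((\<lambda>t. x + t *\<^sub>R h) has_derivative (\<lambda>s. s *\<^sub>R h)) (at t)"
    by (auto intro!: derivative_eq_intros)
  ultimately have "((\<lambda>t. f (x + t *\<^sub>R h)) has_derivative (\<lambda>s. (s *\<^sub>R h) \<bullet> grad f (x + t *\<^sub>R h))) (at t)"
    by (rule has_derivative_compose[rotated])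
  then show ?thesis
    by (simp add: has_field_derivative_def inner_commute mult_commute_abs)
qed

section \<open>Interpolation inequalities for smooth convex functions\<close>

text \<open>
  The Lipschitz bound on the gradient controls the growth of the slope along the segment from
  \<open>x\<close> to \<open>x + h\<close>: the difference of \<open>f\<close> and the quadratic upper model has nonpositive
  derivative there, and it vanishes at \<open>x\<close>.
\<close>
lemma smooth_upper_bound:
  assumes "smooth L f"
  shows "f (x + h) \<le> f x + grad f x \<bullet> h + L / 2 * (norm h)\<^sup>2"
proof -
  have diff: "\<And>z. f differentiable (at z)"
    and lip: "\<And>z k. norm (grad f (z + k) - grad f z) \<le> L * norm k"
    using assms unfolding smooth_def by auto
  define \<phi> where "\<phi> t = f (x + t *\<^sub>R h) - t * (grad f x \<bullet> h) - L / 2 * t\<^sup>2 * (norm h)\<^sup>2" for t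
  have "\<phi> 1 \<le> \<phi> 0"
  proof (rule DERIV_nonpos_imp_nonincreasing[of 0 1 \<phi>])
    fix t :: real
    assume t: "0 \<le> t" "t \<le> 1"
    let ?d = "grad f (x + t *\<^sub>R h) \<bullet> h - grad f x \<bullet> h - L * t * (norm h)\<^sup>2"
    have "(\<phi> has_real_derivative ?d) (at t)"
      unfolding \<phi>_def by (auto intro!: derivative_eq_intros DERIV_along_line[OF diff])
    moreover have "?d \<le> 0"
    proof -
      have "grad f (x + t *\<^sub>R h) \<bullet> h - grad f x \<bullet> h = (grad f (x + t *\<^sub>R h) - grad f x) \<bullet> h"
        by (simp add: inner_diff_left)
      also have "\<dots> \<le> norm (grad f (x + t *\<^sub>R h) - grad f x) * norm h"
        by (rule norm_cauchy_schwarz)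
      also have "\<dots> \<le> (L * norm (t *\<^sub>R h)) * norm h"
        by (intro mult_right_mono lip) simp
      also have "\<dots> = L * t * (norm h)\<^sup>2"
        using t by (simp add: power2_eq_square)
      finally show ?thesis by simp
    qed
    ultimately show "\<exists>d. (\<phi> has_real_derivative d) (at t) \<and> d \<le> 0" by blast
  qed simp
  then show ?thesis by (simp add: \<phi>_def)
qed

lemma convex_above_tangent:
  assumes conv: "convex_on UNIV f" and diff: "\<And>z. f differentiable (at z)"
  shows "f x + grad f x \<bullet> h \<le> f (x + h)"
proof -
  let ?\<phi> = "\<lambda>t. f (x + t *\<^sub>R h)"
  have "convex_on UNIV ?\<phi>"
  proof (rule convex_onI)
    fix t a b :: real
    assume t: "0 < t" "t < 1"
    have "x + ((1 - t) *\<^sub>R a + t *\<^sub>R b) *\<^sub>R h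
        = (1 - t) *\<^sub>R (x + a *\<^sub>R h) + t *\<^sub>R (x + b *\<^sub>R h)"
      by (simp add: algebra_simps)
    then show "?\<phi> ((1 - t) *\<^sub>R a + t *\<^sub>R b) \<le> (1 - t) * ?\<phi> a + t * ?\<phi> b"
      using convex_onD[OF conv, of t "x + a *\<^sub>R h" "x + b *\<^sub>R h"] t by simp
  qed simp
  then have "?\<phi> 1 - ?\<phi> 0 \<ge> (grad f (x + 0 *\<^sub>R h) \<bullet> h) * (1 - 0)"
    using DERIV_along_line[OF diff, of x h 0] by (intro convex_on_imp_above_tangent[of UNIV]) auto
  then show ?thesis by simp
qed

text \<open>
  At every point \<open>w\<close>, the tangent plane at \<open>x\<close> lies below \<open>f w\<close>, which lies below the
  quadratic model at \<open>y\<close>. The resulting inequality between \<open>f x\<close> and \<open>f y\<close> is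
  strongest at the \<open>w\<close> that minimizes the quadratic model minus the tangent plane.
\<close>
lemma smooth_convex_interpolation:
  assumes "convex_on UNIV f" and "smooth L f" and "L > 0"
  shows "f x + grad f x \<bullet> (y - x) + 1 / (2 * L) * (norm (grad f y - grad f x))\<^sup>2 \<le> f y"
proof -
  define d where "d = grad f y - grad f x"
  \<comment> \<open>The quadratic model at \<open>y\<close> minus the tangent plane at \<open>x\<close> has gradient
    \<open>d + L *\<^sub>R (w - y)\<close> as a function of \<open>w\<close>; this is its zero.\<close>
  define w where "w = y - (1 / L) *\<^sub>R d"
  have "f x + grad f x \<bullet> (w - x) \<le> f w"
    using convex_above_tangent[OF assms(1), of x "w - x"] assms(2) by (simp add: smooth_def)
  moreover have "f w \<le> f y + grad f y \<bullet> (w - y) + L / 2 * (norm (w - y))\<^sup>2"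
    using smooth_upper_bound[OF assms(2), of y "w - y"] by simp
  moreover have "grad f x \<bullet> (w - x) = grad f x \<bullet> (y - x) - (1 / L) * (grad f x \<bullet> d)"
    by (simp add: w_def inner_diff_right)
  moreover have "grad f y \<bullet> (w - y) = - (1 / L) * (grad f x \<bullet> d) - (1 / L) * (norm d)\<^sup>2"
    by (simp add: w_def d_def power2_norm_eq_inner inner_diff_left inner_diff_right algebra_simps)
  moreover have "L / 2 * (norm (w - y))\<^sup>2 = 1 / (2 * L) * (norm d)\<^sup>2"
    using \<open>L > 0\<close> by (simp add: w_def power2_eq_square)
  moreover have "(1 / L) * (norm d)\<^sup>2 = 2 * (1 / (2 * L) * (norm d)\<^sup>2)"
    by simp
  ultimately show ?thesis unfolding d_def[symmetric] by linarith
qed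

section \<open>Stationarity\<close>

lemma grad_orthogonal_of_min_along_line:
  assumes diff: "\<And>z. f differentiable (at z)" and min: "\<And>t. f x \<le> f (x + t *\<^sub>R h)"
  shows "grad f x \<bullet> h = 0"
  using DERIV_local_min[OF DERIV_along_line[OF diff, of x h 0], of 1] min by simp

section \<open>Blocks of coordinates\<close>

lemma block_nth: "block blk i x $ k = (if blk k = i then x $ k else 0)"
  by (simp add: block_def U_def transpose_def matrix_vector_mult_def if_distrib if_distribR
      cong: if_cong)

lemma U_mult_eq_block: "U blk i *v x = block blk i x"
proof -
  have "transpose (U blk i) = U blk i"
    by (auto simp: vec_eq_iff transpose_def U_def)
  then show ?thesis by (simp add: block_def)
qed

text \<open>
  Every coordinate belongs to exactly one of the blocks \<open>1, \<dots>, p\<close>, so after exchanging the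
  sums over blocks and coordinates each product of coordinates is counted once.
\<close>
lemma sum_inner_block:
  assumes "range blk \<subseteq> {1..p}"
  shows "(\<Sum>i=1..p. block blk i x \<bullet> block blk i y) = x \<bullet> y"
proof -
  have "(\<Sum>i=1..p. block blk i x \<bullet> block blk i y)
      = (\<Sum>i=1..p. \<Sum>k\<in>UNIV. if blk k = i then x $ k * y $ k else 0)"
    by (auto simp: inner_vec_def block_nth intro!: sum.cong)
  also have "\<dots> = (\<Sum>k\<in>UNIV. \<Sum>i=1..p. if blk k = i then x $ k * y $ k else 0)"
    by (rule sum.swap)
  also have "\<dots> = x \<bullet> y"
    using assms by (auto simp: inner_vec_def sum.delta' image_subset_iff intro!: sum.cong)
  finally show ?thesis .
qed

lemma block_diff: "block blk i (x - y) = block blk i x - block blk i y"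
  by (simp add: vec_eq_iff block_nth)

lemma blockwise_interpolation:
  assumes "range blk \<subseteq> {1..p}" and "convex_on UNIV f" and "smooth L f" and "L > 0"
  shows "f x + (\<Sum>i=1..p. block blk i (grad f x) \<bullet> (block blk i y - block blk i x))
           + 1 / (2 * L) * (\<Sum>i=1..p. (norm (block blk i (grad f y) - block blk i (grad f x)))\<^sup>2)
         \<le> f y"
  using smooth_convex_interpolation[OF assms(2-4), of x y]
  unfolding block_diff[symmetric] power2_norm_eq_inner sum_inner_block[OF assms(1)] .

section \<open>Steps of the algorithms\<close>

lemma block_of_exact_step:
  assumes "is_arg_min f (\<lambda>w. w \<in> {v + U blk i *v \<Delta> | \<Delta>. True}) u" and "j \<noteq> i"
  shows "block blk j u = block blk j v"
  using assms by (auto simp: is_arg_min_def U_mult_eq_block vec_eq_iff block_nth)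

text \<open>
  The direction \<open>block blk i (grad f u)\<close> is admissible for the step, hence orthogonal to the gradient
  at the minimizer \<open>u\<close>; but its inner product with the gradient is its own squared norm.
\<close>
lemma block_grad_of_exact_step:
  assumes diff: "\<And>z. f differentiable (at z)"
    and min: "is_arg_min f (\<lambda>w. w \<in> {v + U blk i *v \<Delta> | \<Delta>. True}) u"
  shows "block blk i (grad f u) = 0"
proof -
  let ?h = "block blk i (grad f u)"
  obtain \<Delta> where u: "u = v + U blk i *v \<Delta>"
    using min unfolding is_arg_min_def by blast
  have "f u \<le> f (u + t *\<^sub>R ?h)" for t
  proof -
    have "u + t *\<^sub>R ?h = v + U blk i *v (\<Delta> + t *\<^sub>R grad f u)"
      unfolding u by (simp add: U_mult_eq_block vec_eq_iff block_nth)
    then show ?thesis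
      using min unfolding is_arg_min_def by (metis (mono_tags, lifting) mem_Collect_eq not_less)
  qed
  then have "grad f u \<bullet> ?h = 0"
    by (rule grad_orthogonal_of_min_along_line[OF diff])
  moreover have "grad f u \<bullet> ?h = ?h \<bullet> ?h"
    by (auto simp: inner_vec_def block_nth intro!: sum.cong)
  ultimately show ?thesis by simp
qed

lemma grad_of_global_min:
  assumes diff: "\<And>z. f differentiable (at z)" and min: "is_arg_min f (\<lambda>w. True) u"
  shows "grad f u = 0"
proof -
  have "f u \<le> f (u + t *\<^sub>R grad f u)" for t
    using min unfolding is_arg_min_def by (meson not_less)
  then show ?thesis
    using grad_orthogonal_of_min_along_line[OF diff] by (metis inner_eq_zero_iff)
qed

lemma run_data_entry:
  assumes "j \<in> indices alg N"
  shows "pt (run_data alg N f x y xstar) j = run_point x y xstar j"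
    and "gr (run_data alg N f x y xstar) j = grad f (run_point x y xstar j)"
    and "fv (run_data alg N f x y xstar) j = f (run_point x y xstar j)"
  using assms by (simp_all add: pt_def gr_def fv_def run_data_def Let_def)

text \<open>
  A data set is undefined outside its index set, so it agrees with the run only on the finitely many
  entries that the update rules read. The ranges matter: step \<open>n\<close> uses gradients and
  intermediate points with index \<open>n - 1\<close>, hence none with index \<open>N\<close>.
\<close>
lemma ccd_updates_cong:
  assumes "\<And>n. n \<le> N \<Longrightarrow> x n = x' n" and "\<And>n. n < N \<Longrightarrow> gx n = gx' n"
  shows "ccd_updates blk p N \<alpha> x gx \<longleftrightarrow> ccd_updates blk p N \<alpha> x' gx'"
  unfolding ccd_updates_def using assms by (intro ball_cong refl) auto

lemma cacd_updates_cong: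
  assumes "\<And>n. n \<le> N \<Longrightarrow> x n = x' n" and "\<And>n. n < N \<Longrightarrow> y n = y' n"
    and "\<And>n. n < N \<Longrightarrow> gy n = gy' n"
  shows "cacd_updates blk p N L x y gy \<longleftrightarrow> cacd_updates blk p N L x' y' gy'"
  unfolding cacd_updates_def using assms
  by (intro ex_cong1 conj_cong ball_cong refl) auto

lemma pep_updates_run_data:
  assumes diff: "\<And>z. f differentiable (at z)" and run: "is_run blk alg L p N f x y"
  shows "pep_updates blk alg L p N (run_data alg N f x y xstar)"
proof -
  let ?S = "run_data alg N f x y xstar"
  have X: "pt ?S (X n) = x n" "gr ?S (X n) = grad f (x n)" if "n \<le> N" for n
    using that by (simp_all add: run_data_entry indices_def)
  show ?thesis
  proof (cases alg)
    case (CCD \<alpha>)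
    then show ?thesis
      using run ccd_updates_cong[of N "\<lambda>n. pt ?S (X n)" x "\<lambda>n. gr ?S (X n)" "\<lambda>n. grad f (x n)"] X
      by simp
  next
    case AM
    have "is_arg_min f (\<lambda>w. w \<in> {x (n-1) + U blk (cyc p n) *v \<Delta> | \<Delta>. True}) (x n)"
      if "n \<in> {1..N}" for n
      using run that AM by simp
    from block_of_exact_step[OF this] block_grad_of_exact_step[OF diff this] show ?thesis
      using X AM by auto
  next
    case CACD
    then have "pt ?S (Y n) = y n" "gr ?S (Y n) = grad f (y n)" if "n < N" for n
      using that by (simp_all add: run_data_entry indices_def)
    then show ?thesis
      using run CACD X cacd_updates_cong[of N "\<lambda>n. pt ?S (X n)" x "\<lambda>n. pt ?S (Y n)" y
          "\<lambda>n. gr ?S (Y n)" "\<lambda>n. grad f (y n)"]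
      by simp
  qed
qed

theorem theorem3p1:
  fixes blk :: "'n::finite \<Rightarrow> nat"
    and f :: "real^'n \<Rightarrow> real"
    and p K N :: nat
    and L R :: real
    and alg :: algorithm
    and Perf Init :: "'n dataset \<Rightarrow> real"
    and x y :: "nat \<Rightarrow> real^'n"
    and xstar :: "real^'n"
  assumes "p \<ge> 1" and "K \<ge> 1" and "N = p * K" and "L > 0" and "R > 0"
    and "range blk \<subseteq> {1..p}"
    and "convex_on UNIV f" and "smooth L f"
    and "is_arg_min f (\<lambda>w. True) xstar"
    and "is_run blk alg L p N f x y"
    and "Init (run_data alg N f x y xstar) \<le> R\<^sup>2"
  shows "ereal (Perf (run_data alg N f x y xstar)) \<le> pep_value blk alg Perf Init L p K R"
proof -
  let ?S = "run_data alg N f x y xstar"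
  have diff: "f differentiable (at z)" for z
    using \<open>smooth L f\<close> by (simp add: smooth_def)
  have "?S \<in> extensional (indices alg N)"
    by (simp add: run_data_def)
  moreover have "gr ?S Star = 0"
    using grad_of_global_min[OF diff \<open>is_arg_min f (\<lambda>w. True) xstar\<close>]
    by (simp add: run_data_entry indices_def)
  moreover have "fv ?S n \<ge> fv ?S l
      + (\<Sum>i=1..p. block blk i (gr ?S l) \<bullet> (block blk i (pt ?S n) - block blk i (pt ?S l)))
      + 1 / (2 * L) * (\<Sum>i=1..p. (norm (block blk i (gr ?S n) - block blk i (gr ?S l)))\<^sup>2)"
    if "n \<in> indices alg N" "l \<in> indices alg N" for n l
    unfolding run_data_entry[OF that(1)] run_data_entry[OF that(2)]
    by (rule blockwise_interpolation) fact+
  moreover have "pep_updates blk alg L p N ?S"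
    using diff \<open>is_run blk alg L p N f x y\<close> by (rule pep_updates_run_data)
  ultimately have "?S \<in> pep_feasible blk alg Init L p K R"
    using \<open>Init ?S \<le> R\<^sup>2\<close> unfolding pep_feasible_def \<open>N = p * K\<close> by blast
  then show ?thesis
    unfolding pep_value_def by (rule SUP_upper)
qed

end
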